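(* Let $r\ge 2$, let $N=\binom{n}{d}$, and let $X$ be a connected, undirected $d$-dimensional simplicial complex on the vertex set $\{1,\dots,n\}$ with complete $(d-1)$-skeleton that is $r$-regular (i.e., every $(d-1)$-simplex has degree $r$) and has diameter $D$. Then the number of $(d-1)$-simplices $N$ satisfies the inequality $$N\;\le\; 1+r\sum_{i=0}^{D-1}(r-1)^i \;=\; 1+r\cdot\frac{(r-1)^D-1}{r-2},\qquad\text{for } r\ge 2.$$ Consequently, the lower bound on the diameter is $$D\;\ge\;\frac{\log\left(1+\frac{(N-1)\big((r-1)d-1\big)}{rd}\right)}{\log\big((r-1)d\big)} .$$
   Context: Let $d\ge 1$ and $n$ be integers with $d+1\le n$. For each $k$, let $X_k$ be the set of all $k$-simplices on the vertex set $\{1,\dots,n\}$, i.e. all subsets of size $k+1$. A $d$-dimensional simplicial complex with complete $(d-1)$-skeleton is $X=\left(\bigcup_{k=0}^{d-1}X_k\right)\cup X^d$ for some subset $X^d\subseteq X_d$. Thus the number of $(d-1)$-simplices is $|X_{d-1}|=\binom{n}{d}$. Undirected means that simplices carry no orientation. The degree of a $(d-1)$-simplex $\sigma$ is the number of $d$-simplices $\tau\in X^d$ with $\sigma\subset\tau$. Two distinct $(d-1)$-simplices are neighbors if they are both contained in a common $d$-simplex of $X^d$. A path between $(d-1)$-simplices is a sequence of $(d-1)$-simplices in which consecutive ones are neighbors; its length is the number of steps. The distance $d_X(\sigma_1,\sigma_2)$ between two $(d-1)$-simplices is the length of a shortest path connecting them. $X$ is connected if every two $(d-1)$-simplices are joined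 by a path. The eccentricity of a $(d-1)$-simplex $\sigma$ is the maximum distance from $\sigma$ to any other $(d-1)$-simplex, and the diameter $D$ of $X$ is the maximum eccentricity among all $(d-1)$-simplices.
   Formalization: The first bound is false as printed for d≥2 (all four triangles on 4 vertices: r=2, D=2, N=6>5); it is proved with rd and (r-1)d in place of r and r-1 in the sum and closed form. Where (r-1)d=1 the 0/0 quotients are read as their limits D and (N-1)/(rd). *)

theory Defs
  imports Complex_Main
begin

definition simplices :: "nat \<Rightarrow> nat \<Rightarrow> nat set set" where
  "simplices n k = {\<sigma>. \<sigma> \<subseteq> {1..n} \<and> card \<sigma> = k + 1}"

text \<open>The empty face is not a member of a complex.\<close>

definition complete_skeleton_complex :: "nat \<Rightarrow> nat \<Rightarrow> nat set set \<Rightarrow> bool" where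
  "complete_skeleton_complex n d X \<longleftrightarrow>
     (\<exists>T \<subseteq> simplices n d. X = (\<Union>k<d. simplices n k) \<union> T)"

definition faces :: "nat \<Rightarrow> nat set set \<Rightarrow> nat set set" where
  "faces k X = {\<sigma> \<in> X. card \<sigma> = k + 1}"

definition simplex_degree :: "nat \<Rightarrow> nat set set \<Rightarrow> nat set \<Rightarrow> nat" where
  "simplex_degree d X \<sigma> = card {\<tau> \<in> faces d X. \<sigma> \<subset> \<tau>}"

definition regular_complex :: "nat \<Rightarrow> nat \<Rightarrow> nat set set \<Rightarrow> bool" where
  "regular_complex d r X \<longleftrightarrow> (\<forall>\<sigma> \<in> faces (d - 1) X. simplex_degree d X \<sigma> = r)"

text \<open>
  The degree counts \<open>d\<close>-simplices, not neighbors: a \<open>(d - 1)\<close>-simplex of degree \<open>r\<close> has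
  \<open>r * d\<close> neighbors, since each \<open>d\<close>-simplex containing it has \<open>d\<close> further
  \<open>(d - 1)\<close>-faces. In a breadth-first search every later simplex reaches at most
  \<open>(r - 1) * d\<close> new ones.
\<close>

definition neighbors :: "nat \<Rightarrow> nat set set \<Rightarrow> nat set \<Rightarrow> nat set \<Rightarrow> bool" where
  "neighbors d X \<sigma> \<sigma>' \<longleftrightarrow> \<sigma> \<noteq> \<sigma>' \<and> (\<exists>\<tau> \<in> faces d X. \<sigma> \<subseteq> \<tau> \<and> \<sigma>' \<subseteq> \<tau>)"

definition simplex_path ::
    "nat \<Rightarrow> nat set set \<Rightarrow> nat set \<Rightarrow> nat set list \<Rightarrow> nat set \<Rightarrow> bool" where
  "simplex_path d X \<sigma> p \<sigma>' \<longleftrightarrow>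
     p \<noteq> [] \<and> hd p = \<sigma> \<and> last p = \<sigma>' \<and> set p \<subseteq> faces (d - 1) X \<and>
     successively (neighbors d X) p"

definition connected_complex :: "nat \<Rightarrow> nat set set \<Rightarrow> bool" where
  "connected_complex d X \<longleftrightarrow>
     (\<forall>\<sigma> \<in> faces (d - 1) X. \<forall>\<sigma>' \<in> faces (d - 1) X. \<exists>p. simplex_path d X \<sigma> p \<sigma>')"

text \<open>
  A path with \<open>k\<close> steps visits \<open>k + 1\<close> simplices. The distance is meaningful only for
  simplices that are joined by some path, the eccentricity and the diameter only for
  connected complexes with at least two \<open>(d - 1)\<close>-simplices.
\<close>

definition simplex_dist :: "nat \<Rightarrow> nat set set \<Rightarrow> nat set \<Rightarrow> nat set \<Rightarrow> nat" where
  "simplex_dist d X \<sigma> \<sigma>' = (LEAST k. \<exists>p. simplex_path d X \<sigma> p \<sigma>' \<and> length p = k + 1)"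

definition eccentricity :: "nat \<Rightarrow> nat set set \<Rightarrow> nat set \<Rightarrow> nat" where
  "eccentricity d X \<sigma> = Max (simplex_dist d X \<sigma> ` (faces (d - 1) X - {\<sigma>}))"

definition complex_diameter :: "nat \<Rightarrow> nat set set \<Rightarrow> nat" where
  "complex_diameter d X = Max (eccentricity d X ` faces (d - 1) X)"

lemma faces_complete_skeleton:
  assumes "complete_skeleton_complex n d X" "1 \<le> d"
  shows "faces (d - 1) X = simplices n (d - 1)"
proof -
  obtain T where T: "T \<subseteq> simplices n d" "X = (\<Union>k<d. simplices n k) \<union> T"
    using assms(1) unfolding complete_skeleton_complex_def by blast
  have "d - 1 < d"
    using assms(2) by simp
  then have "simplices n (d - 1) \<subseteq> faces (d - 1) X"
    unfolding T(2) faces_def using assms(2) by (auto simp: simplices_def intro!: bexI[of _ "d - 1"])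
  moreover have "\<sigma> \<in> simplices n (d - 1)" if "\<sigma> \<in> faces (d - 1) X" for \<sigma>
    using that T assms(2) by (auto simp: faces_def simplices_def)
  ultimately show ?thesis
    by blast
qed

lemma card_faces_complete_skeleton:
  assumes "complete_skeleton_complex n d X" "1 \<le> d"
  shows "card (faces (d - 1) X) = n choose d"
  using n_subsets[of "{1..n}" d] assms(2)
  unfolding faces_complete_skeleton[OF assms] by (simp add: simplices_def)

end

theory Submission
  imports Defs
begin

text \<open>
  The bound is the Moore bound for the graph of \<open>(d - 1)\<close>-simplices. Fix a base simplex \<open>\<sigma>\<close> and
  sort all \<open>(d - 1)\<close>-simplices into spheres by their distance from \<open>\<sigma>\<close>. A simplex of degree \<open>r\<close> has
  at most \<open>r * d\<close> neighbors, so the sphere of radius \<open>1\<close> has at most \<open>r * d\<close> members. A simplex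
  \<open>\<rho>\<close> in a later sphere is a neighbor of some \<open>\<pi>\<close> in the preceding sphere, and both lie in a common
  \<open>d\<close>-simplex \<open>\<tau>\<close>. All facets of \<open>\<tau>\<close> are equal or adjacent to \<open>\<pi>\<close>, hence no farther
  from \<open>\<sigma>\<close> than \<open>\<rho>\<close>; only the other \<open>r - 1\<close> cofaces of \<open>\<rho>\<close> lead outwards. So from there on each
  sphere is at most \<open>(r - 1) * d\<close> times as large as its predecessor (\<open>card_sphere_step\<close>).

  By connectedness the spheres of radius at most \<open>D\<close> exhaust the \<open>(d - 1)\<close>-simplices, and summing
  their sizes gives the bound on \<open>N\<close>. The bound on \<open>D\<close> follows by summing the geometric series and
  taking logarithms; the ratio \<open>(r - 1) * d\<close> is at least \<open>1\<close>, and when it equals \<open>1\<close> the series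
  is linear in \<open>D\<close>, which is why that case is stated separately.
\<close>

section \<open>Distances along paths of simplices\<close>

lemma simplex_dist_le:
  assumes "simplex_path d X \<sigma> p \<rho>" "length p = k + 1"
  shows "simplex_dist d X \<sigma> \<rho> \<le> k"
  unfolding simplex_dist_def by (rule Least_le) (use assms in blast)

lemma shortest_simplex_path:
  assumes "simplex_path d X \<sigma> p \<rho>"
  obtains p' where "simplex_path d X \<sigma> p' \<rho>" "length p' = simplex_dist d X \<sigma> \<rho> + 1"
proof -
  have "length p = (length p - 1) + 1"
    using assms by (simp add: simplex_path_def Suc_leI)
  then have "\<exists>k p'. simplex_path d X \<sigma> p' \<rho> \<and> length p' = k + 1"
    using assms by blast
  from LeastI_ex[OF this] show ?thesis
    unfolding simplex_dist_def[symmetric] using that by blast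
qed

lemma simplex_dist_self:
  assumes "\<sigma> \<in> faces (d - 1) X"
  shows "simplex_dist d X \<sigma> \<sigma> = 0"
  using simplex_dist_le[of d X \<sigma> "[\<sigma>]" \<sigma> 0] assms by (simp add: simplex_path_def)

lemma simplex_dist_eq_0D:
  assumes "simplex_path d X \<sigma> p \<rho>" "simplex_dist d X \<sigma> \<rho> = 0"
  shows "\<rho> = \<sigma>"
proof -
  obtain p' where "simplex_path d X \<sigma> p' \<rho>" "length p' = 1"
    using shortest_simplex_path[OF assms(1)] assms(2) by auto
  then show ?thesis
    by (auto simp: simplex_path_def length_Suc_conv)
qed

lemma simplex_path_snoc:
  assumes "simplex_path d X \<sigma> p \<pi>" "neighbors d X \<pi> \<rho>" "\<rho> \<in> faces (d - 1) X"
  shows "simplex_path d X \<sigma> (p @ [\<rho>]) \<rho>"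
  using assms by (auto simp: simplex_path_def successively_append_iff)

lemma simplex_dist_neighbor_le:
  assumes "simplex_path d X \<sigma> p \<pi>" "neighbors d X \<pi> \<rho>" "\<rho> \<in> faces (d - 1) X"
  shows "simplex_dist d X \<sigma> \<rho> \<le> simplex_dist d X \<sigma> \<pi> + 1"
proof -
  obtain p' where "simplex_path d X \<sigma> p' \<pi>" "length p' = simplex_dist d X \<sigma> \<pi> + 1"
    using shortest_simplex_path[OF assms(1)] .
  then show ?thesis
    using simplex_dist_le[OF simplex_path_snoc[OF _ assms(2,3)]] by simp
qed

text \<open>The last but one simplex of a shortest path: its prefix is again a shortest path.\<close>

lemma simplex_dist_predecessor:
  assumes "simplex_path d X \<sigma> p \<rho>" "simplex_dist d X \<sigma> \<rho> = Suc i"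
  obtains \<pi> p' where "simplex_path d X \<sigma> p' \<pi>" "\<pi> \<in> faces (d - 1) X"
    "neighbors d X \<pi> \<rho>" "simplex_dist d X \<sigma> \<pi> = i"
proof -
  obtain p1 where p1: "simplex_path d X \<sigma> p1 \<rho>" "length p1 = i + 2"
    using shortest_simplex_path[OF assms(1)] assms(2) by auto
  obtain p2 where p2: "p1 = p2 @ [\<rho>]" "p2 \<noteq> []"
  proof
    show "p1 = butlast p1 @ [\<rho>]"
      using p1 by (auto simp: simplex_path_def)
    show "butlast p1 \<noteq> []"
      using p1(2) by (cases p1 rule: rev_cases) auto
  qed
  let ?\<pi> = "last p2"
  have path: "simplex_path d X \<sigma> p2 ?\<pi>" and nb: "neighbors d X ?\<pi> \<rho>"
    and mem: "?\<pi> \<in> faces (d - 1) X" "\<rho> \<in> faces (d - 1) X"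
    using p1(1) p2 by (auto simp: simplex_path_def successively_append_iff)
  have "simplex_dist d X \<sigma> ?\<pi> \<le> i"
    using simplex_dist_le[OF path] p1(2) p2(1) by simp
  moreover have "Suc i \<le> simplex_dist d X \<sigma> ?\<pi> + 1"
    using simplex_dist_neighbor_le[OF path nb mem(2)] assms(2) by simp
  ultimately show ?thesis
    using that[OF path mem(1) nb] by simp
qed

lemma simplex_dist_le_diameter:
  assumes "finite (faces (d - 1) X)" "\<sigma> \<in> faces (d - 1) X" "\<rho> \<in> faces (d - 1) X"
  shows "simplex_dist d X \<sigma> \<rho> \<le> complex_diameter d X"
proof (cases "\<rho> = \<sigma>")
  case True
  then show ?thesis
    using simplex_dist_self[OF assms(2)] by simp
next
  case False
  then have "simplex_dist d X \<sigma> \<rho> \<le> eccentricity d X \<sigma>"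
    unfolding eccentricity_def using assms by (intro Max_ge) auto
  also have "\<dots> \<le> complex_diameter d X"
    unfolding complex_diameter_def using assms by (intro Max_ge) auto
  finally show ?thesis .
qed

section \<open>Growth of spheres\<close>

definition cofaces :: "nat \<Rightarrow> nat set set \<Rightarrow> nat set \<Rightarrow> nat set set" where
  "cofaces d X \<sigma> = {\<tau> \<in> faces d X. \<sigma> \<subset> \<tau>}"

definition other_facets :: "nat \<Rightarrow> nat set \<Rightarrow> nat set \<Rightarrow> nat set set" where
  "other_facets d \<sigma> \<tau> = {\<rho>. \<rho> \<subseteq> \<tau> \<and> card \<rho> = d} - {\<sigma>}"

definition sphere :: "nat \<Rightarrow> nat set set \<Rightarrow> nat set \<Rightarrow> nat \<Rightarrow> nat set set" where
  "sphere d X \<sigma> i = {\<rho> \<in> faces (d - 1) X. simplex_dist d X \<sigma> \<rho> = i}"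

lemma card_other_facets:
  assumes "1 \<le> d" "\<sigma> \<in> faces (d - 1) X" "\<tau> \<in> cofaces d X \<sigma>"
  shows "card (other_facets d \<sigma> \<tau>) = d"
proof -
  have \<tau>: "card \<tau> = d + 1" "\<sigma> \<subseteq> \<tau>" "card \<sigma> = d"
    using assms by (auto simp: cofaces_def faces_def)
  then have "finite \<tau>"
    by (intro card_ge_0_finite) simp
  then have "card {\<rho>. \<rho> \<subseteq> \<tau> \<and> card \<rho> = d} = d + 1"
    using n_subsets[of \<tau> d] \<tau>(1) by simp
  then show ?thesis
    unfolding other_facets_def using \<tau> by simp
qed

lemma neighbors_via_coface:
  assumes "1 \<le> d" "\<sigma> \<in> faces (d - 1) X" "\<rho> \<in> faces (d - 1) X" "neighbors d X \<sigma> \<rho>"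
  obtains \<tau> where "\<tau> \<in> cofaces d X \<sigma>" "\<tau> \<in> cofaces d X \<rho>" "\<rho> \<in> other_facets d \<sigma> \<tau>"
proof -
  obtain \<tau> where \<tau>: "\<sigma> \<noteq> \<rho>" "\<tau> \<in> faces d X" "\<sigma> \<subseteq> \<tau>" "\<rho> \<subseteq> \<tau>"
    using assms(4) by (auto simp: neighbors_def)
  have card: "card \<sigma> = d" "card \<rho> = d" "card \<tau> = d + 1"
    using assms(1-3) \<tau>(2) by (auto simp: faces_def)
  then have "\<sigma> \<noteq> \<tau>" "\<rho> \<noteq> \<tau>"
    by auto
  then show ?thesis
    using that[of \<tau>] \<tau> card(2) by (auto simp: cofaces_def other_facets_def)
qed

lemma card_Union_other_facets_le:
  assumes "1 \<le> d" "\<sigma> \<in> faces (d - 1) X" "A \<subseteq> cofaces d X \<sigma>" "finite A"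
  shows "card (\<Union>\<tau>\<in>A. other_facets d \<sigma> \<tau>) \<le> card A * d"
proof -
  have "card (\<Union>\<tau>\<in>A. other_facets d \<sigma> \<tau>) \<le> (\<Sum>\<tau>\<in>A. card (other_facets d \<sigma> \<tau>))"
    using assms(4) by (rule card_UN_le)
  also have "\<dots> = (\<Sum>\<tau>\<in>A. d)"
    using card_other_facets[OF assms(1,2)] assms(3) by (intro sum.cong) auto
  finally show ?thesis
    by simp
qed

lemma finite_Union_other_facets:
  assumes "finite A" "A \<subseteq> faces d X"
  shows "finite (\<Union>\<tau>\<in>A. other_facets d \<sigma> \<tau>)"
proof -
  have "finite (other_facets d \<sigma> \<tau>)" if "\<tau> \<in> A" for \<tau>
  proof -
    have "card \<tau> = d + 1"
      using that assms(2) by (auto simp: faces_def)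
    then have "finite \<tau>"
      by (intro card_ge_0_finite) simp
    then show ?thesis
      unfolding other_facets_def by simp
  qed
  then show ?thesis
    using assms(1) by blast
qed

lemma sphere_0_subset:
  assumes "connected_complex d X" "\<sigma> \<in> faces (d - 1) X"
  shows "sphere d X \<sigma> 0 \<subseteq> {\<sigma>}"
  using assms simplex_dist_eq_0D unfolding connected_complex_def sphere_def by blast

lemma sphere_Suc_predecessor:
  assumes "connected_complex d X" "\<sigma> \<in> faces (d - 1) X" "\<rho> \<in> sphere d X \<sigma> (Suc i)"
  obtains \<pi> where "\<pi> \<in> sphere d X \<sigma> i" "neighbors d X \<pi> \<rho>"
proof -
  have \<rho>: "\<rho> \<in> faces (d - 1) X" "simplex_dist d X \<sigma> \<rho> = Suc i"
    using assms(3) by (auto simp: sphere_def)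
  obtain p where "simplex_path d X \<sigma> p \<rho>"
    using assms(1,2) \<rho>(1) unfolding connected_complex_def by blast
  from this \<rho>(2) show ?thesis
    by (rule simplex_dist_predecessor) (rule that, auto simp: sphere_def)
qed

lemma card_sphere_1_le:
  assumes "1 \<le> d" "connected_complex d X" "regular_complex d r X" "finite (faces d X)"
    "\<sigma> \<in> faces (d - 1) X"
  shows "card (sphere d X \<sigma> 1) \<le> r * d"
proof -
  let ?U = "\<Union>\<tau>\<in>cofaces d X \<sigma>. other_facets d \<sigma> \<tau>"
  have fin: "finite (cofaces d X \<sigma>)"
    using assms(4) by (simp add: cofaces_def)
  have "sphere d X \<sigma> 1 \<subseteq> ?U"
  proof
    fix \<rho> assume \<rho>: "\<rho> \<in> sphere d X \<sigma> 1"
    then obtain \<pi> where "\<pi> \<in> sphere d X \<sigma> 0" "neighbors d X \<pi> \<rho>"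
      using sphere_Suc_predecessor[OF assms(2,5), of \<rho> 0] by auto
    then have "neighbors d X \<sigma> \<rho>"
      using sphere_0_subset[OF assms(2,5)] by auto
    then show "\<rho> \<in> ?U"
      using neighbors_via_coface[OF assms(1,5), of \<rho>] \<rho> by (auto simp: sphere_def)
  qed
  then have "card (sphere d X \<sigma> 1) \<le> card ?U"
    using fin by (intro card_mono finite_Union_other_facets[where d = d and X = X])
      (auto simp: cofaces_def)
  also have "\<dots> \<le> card (cofaces d X \<sigma>) * d"
    using card_Union_other_facets_le[OF assms(1,5) order_refl fin] .
  also have "card (cofaces d X \<sigma>) = r"
    using assms(3,5) by (simp add: regular_complex_def simplex_degree_def cofaces_def)
  finally show ?thesis .
qed

text \<open>
  One coface of each \<open>\<rho>\<close> in the sphere is spent on the way back: it also contains a simplex \<open>\<pi>\<close> one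
  step closer to \<open>\<sigma>\<close>, so its other facets are neighbors of \<open>\<pi>\<close> and cannot lie in the next sphere.
\<close>

lemma card_sphere_step:
  assumes "1 \<le> d" "connected_complex d X" "regular_complex d r X"
    "finite (faces d X)" "finite (faces (d - 1) X)" "\<sigma> \<in> faces (d - 1) X"
  shows "card (sphere d X \<sigma> (Suc (Suc i))) \<le> card (sphere d X \<sigma> (Suc i)) * ((r - 1) * d)"
proof -
  let ?S = "sphere d X \<sigma>"
  have "\<exists>\<tau> \<in> cofaces d X \<rho>. \<exists>\<pi> \<in> ?S i. \<pi> \<subseteq> \<tau>" if \<rho>: "\<rho> \<in> ?S (Suc i)" for \<rho>
  proof -
    obtain \<pi> where \<pi>: "\<pi> \<in> ?S i" "neighbors d X \<pi> \<rho>"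
      using sphere_Suc_predecessor[OF assms(2,6) \<rho>] .
    obtain \<tau> where "\<tau> \<in> cofaces d X \<pi>" "\<tau> \<in> cofaces d X \<rho>"
      using neighbors_via_coface[OF assms(1) _ _ \<pi>(2)] \<pi>(1) \<rho> by (auto simp: sphere_def)
    then show ?thesis
      using \<pi>(1) by (auto simp: cofaces_def)
  qed
  then obtain inward where inward: "inward \<rho> \<in> cofaces d X \<rho>" "\<exists>\<pi> \<in> ?S i. \<pi> \<subseteq> inward \<rho>"
    if "\<rho> \<in> ?S (Suc i)" for \<rho>
    by metis
  let ?A = "\<lambda>\<rho>. cofaces d X \<rho> - {inward \<rho>}"
  let ?U = "\<lambda>\<rho>. \<Union>\<tau>\<in>?A \<rho>. other_facets d \<rho> \<tau>"
  have fin: "finite (?S (Suc i))" "finite (cofaces d X \<rho>)" for \<rho>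
    using assms(4,5) by (auto simp: sphere_def cofaces_def)
  have sub: "?S (Suc (Suc i)) \<subseteq> (\<Union>\<rho>\<in>?S (Suc i). ?U \<rho>)"
  proof
    fix \<rho>' assume \<rho>': "\<rho>' \<in> ?S (Suc (Suc i))"
    then have mem': "\<rho>' \<in> faces (d - 1) X" "simplex_dist d X \<sigma> \<rho>' = Suc (Suc i)"
      by (auto simp: sphere_def)
    obtain \<rho> where \<rho>: "\<rho> \<in> ?S (Suc i)" "neighbors d X \<rho> \<rho>'"
      using sphere_Suc_predecessor[OF assms(2,6) \<rho>'] .
    obtain \<tau> where \<tau>: "\<tau> \<in> cofaces d X \<rho>" "\<tau> \<in> cofaces d X \<rho>'" "\<rho>' \<in> other_facets d \<rho> \<tau>"
      using neighbors_via_coface[OF assms(1) _ mem'(1) \<rho>(2)] \<rho>(1) by (auto simp: sphere_def)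
    \<comment> \<open>Through \<open>inward \<rho>\<close>, \<open>\<rho>'\<close> would be one step from the sphere of radius \<open>i\<close>.\<close>
    have "\<tau> \<noteq> inward \<rho>"
    proof
      assume "\<tau> = inward \<rho>"
      then obtain \<pi> where \<pi>: "\<pi> \<in> faces (d - 1) X" "simplex_dist d X \<sigma> \<pi> = i" "\<pi> \<subseteq> \<tau>"
        using inward(2)[OF \<rho>(1)] by (auto simp: sphere_def)
      then have "neighbors d X \<pi> \<rho>'"
        using mem'(2) \<tau>(2) by (auto simp: neighbors_def cofaces_def)
      moreover obtain p where "simplex_path d X \<sigma> p \<pi>"
        using assms(2,6) \<pi>(1) unfolding connected_complex_def by blast
      ultimately have "simplex_dist d X \<sigma> \<rho>' \<le> i + 1"
        using simplex_dist_neighbor_le[of d X \<sigma> p \<pi> \<rho>'] mem'(1) \<pi>(2) by simp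
      then show False
        using mem'(2) by simp
    qed
    then show "\<rho>' \<in> (\<Union>\<rho>\<in>?S (Suc i). ?U \<rho>)"
      using \<rho>(1) \<tau> by blast
  qed
  have "finite (?U \<rho>)" for \<rho>
    using fin(2) by (intro finite_Union_other_facets[where d = d and X = X])
      (auto simp: cofaces_def)
  then have "finite (\<Union>\<rho>\<in>?S (Suc i). ?U \<rho>)"
    by (rule finite_UN_I[OF fin(1)])
  then have "card (?S (Suc (Suc i))) \<le> card (\<Union>\<rho>\<in>?S (Suc i). ?U \<rho>)"
    using sub by (rule card_mono)
  also have "\<dots> \<le> (\<Sum>\<rho>\<in>?S (Suc i). card (?U \<rho>))"
    using fin(1) by (rule card_UN_le)
  also have "\<dots> \<le> (\<Sum>\<rho>\<in>?S (Suc i). (r - 1) * d)"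
  proof (rule sum_mono)
    fix \<rho> assume \<rho>: "\<rho> \<in> ?S (Suc i)"
    then have mem: "\<rho> \<in> faces (d - 1) X"
      by (simp add: sphere_def)
    have "card (?U \<rho>) \<le> card (?A \<rho>) * d"
      using card_Union_other_facets_le[OF assms(1) mem, of "?A \<rho>"] fin(2) by auto
    moreover have "card (cofaces d X \<rho>) = r"
      using assms(3) mem by (simp add: regular_complex_def simplex_degree_def cofaces_def)
    ultimately show "card (?U \<rho>) \<le> (r - 1) * d"
      using inward(1)[OF \<rho>] by simp
  qed
  finally show ?thesis
    by simp
qed

lemma card_sphere_Suc_le:
  assumes "1 \<le> d" "connected_complex d X" "regular_complex d r X"
    "finite (faces d X)" "finite (faces (d - 1) X)" "\<sigma> \<in> faces (d - 1) X"
  shows "card (sphere d X \<sigma> (Suc i)) \<le> r * d * ((r - 1) * d) ^ i"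
proof (induction i)
  case 0
  then show ?case
    using card_sphere_1_le[OF assms(1-4,6)] by simp
next
  case (Suc i)
  have "card (sphere d X \<sigma> (Suc (Suc i))) \<le> card (sphere d X \<sigma> (Suc i)) * ((r - 1) * d)"
    by (rule card_sphere_step[OF assms])
  also have "\<dots> \<le> r * d * ((r - 1) * d) ^ i * ((r - 1) * d)"
    using Suc.IH by (rule mult_le_mono1)
  finally show ?case
    by (simp add: mult_ac)
qed

text \<open>
  The spheres around any one simplex, up to the radius given by the diameter, cover all
  \<open>(d - 1)\<close>-simplices; only the center lies in the sphere of radius \<open>0\<close>.
\<close>

lemma card_faces_Moore_bound:
  assumes "1 \<le> d" "connected_complex d X" "regular_complex d r X"
    "finite (faces d X)" "finite (faces (d - 1) X)"
  shows "card (faces (d - 1) X)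
    \<le> 1 + r * d * (\<Sum>i<complex_diameter d X. ((r - 1) * d) ^ i)"
proof (cases "faces (d - 1) X = {}")
  case True
  then show ?thesis
    by simp
next
  case False
  then obtain \<sigma> where \<sigma>: "\<sigma> \<in> faces (d - 1) X"
    by blast
  let ?D = "complex_diameter d X"
  have "faces (d - 1) X = (\<Union>i\<le>?D. sphere d X \<sigma> i)"
    using simplex_dist_le_diameter[OF assms(5) \<sigma>] by (auto simp: sphere_def)
  then have "card (faces (d - 1) X) \<le> (\<Sum>i\<le>?D. card (sphere d X \<sigma> i))"
    using card_UN_le[of "{..?D}" "sphere d X \<sigma>"] by simp
  also have "\<dots> = card (sphere d X \<sigma> 0) + (\<Sum>i<?D. card (sphere d X \<sigma> (Suc i)))"
    by (rule sum.atMost_shift)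
  also have "\<dots> \<le> 1 + (\<Sum>i<?D. r * d * ((r - 1) * d) ^ i)"
    using card_mono[OF _ sphere_0_subset[OF assms(2) \<sigma>]] card_sphere_Suc_le[OF assms \<sigma>]
    by (intro add_mono sum_mono) auto
  finally show ?thesis
    by (simp add: sum_distrib_left)
qed

section \<open>Solving the bound for the diameter\<close>

lemma log_le_if_le_geometric_bound:
  fixes N c q :: real
  assumes "1 < q" "0 < c" "1 \<le> N" "N \<le> 1 + c * ((q ^ D - 1) / (q - 1))"
  shows "ln (1 + (N - 1) * (q - 1) / c) / ln q \<le> real D"
proof -
  have "(N - 1) * (q - 1) / c \<le> q ^ D - 1"
    using assms by (simp add: field_simps)
  moreover have "0 \<le> (N - 1) * (q - 1) / c"
    using assms by simp
  ultimately have "ln (1 + (N - 1) * (q - 1) / c) \<le> ln (q ^ D)"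
    by (intro ln_mono) linarith+
  also have "\<dots> = real D * ln q"
    using assms(1) by (simp add: ln_realpow)
  finally show ?thesis
    using assms(1) by (simp add: pos_divide_le_eq)
qed

theorem theorem1:
  fixes n d r N D :: nat and X :: "nat set set"
  assumes "1 \<le> d" and "d + 1 \<le> n" and "2 \<le> r"
    and "complete_skeleton_complex n d X"
    and "connected_complex d X"
    and "regular_complex d r X"
    and "N = n choose d"
    and "D = complex_diameter d X"
  shows "real N \<le> 1 + real r * real d * (\<Sum>i<D. ((real r - 1) * real d) ^ i)
    \<and> 1 + real r * real d * (\<Sum>i<D. ((real r - 1) * real d) ^ i)
        = 1 + real r * real d *
            (if (real r - 1) * real d = 1 then real D
             else (((real r - 1) * real d) ^ D - 1) / ((real r - 1) * real d - 1))
    \<and> real D \<ge>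
        (if (real r - 1) * real d = 1 then (real N - 1) / (real r * real d)
         else ln (1 + (real N - 1) * ((real r - 1) * real d - 1) / (real r * real d))
                / ln ((real r - 1) * real d))"
proof -
  define q where "q = (real r - 1) * real d"
  define c where "c = real r * real d"
  have "1 \<le> real r - 1" "1 \<le> real d"
    using assms(1,3) by auto
  then have q: "1 \<le> q"
    unfolding q_def using mult_mono[of 1 "real r - 1" 1 "real d"] by simp
  have c: "0 < c"
    using assms(1,3) by (simp add: c_def)
  have N: "1 \<le> real N"
    using assms(2,7) by (simp add: Suc_le_eq zero_less_binomial_iff)
  obtain T where T: "T \<subseteq> simplices n d" "X = (\<Union>k<d. simplices n k) \<union> T"
    using assms(4) unfolding complete_skeleton_complex_def by blast
  then have "X \<subseteq> Pow {1..n}"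
    by (auto simp: simplices_def)
  then have "finite X"
    by (rule finite_subset) simp
  then have "N \<le> 1 + r * d * (\<Sum>i<D. ((r - 1) * d) ^ i)"
    using card_faces_Moore_bound[OF assms(1,5,6)] card_faces_complete_skeleton[OF assms(4,1)]
      assms(7,8) by (simp add: faces_def)
  then have "real N \<le> real (1 + r * d * (\<Sum>i<D. ((r - 1) * d) ^ i))"
    by (rule of_nat_mono)
  then have bound: "real N \<le> 1 + c * (\<Sum>i<D. q ^ i)"
    using assms(3) by (simp add: c_def q_def of_nat_diff)
  have sum: "(\<Sum>i<D. q ^ i) = (if q = 1 then real D else (q ^ D - 1) / (q - 1))"
    using geometric_sum[of q D] by auto
  have "(if q = 1 then (real N - 1) / c else ln (1 + (real N - 1) * (q - 1) / c) / ln q) \<le> real D"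
  proof (cases "q = 1")
    case True
    then show ?thesis
      using bound c by (simp add: pos_divide_le_eq mult.commute)
  next
    case False
    then show ?thesis
      using log_le_if_le_geometric_bound[of q c "real N" D] q c N bound sum by simp
  qed
  then show ?thesis
    using bound sum unfolding c_def q_def by simp
qed

end
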